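(* Let $\lambda\in\mathbb{R}$ and $h>0$ with $\lambda h<0$, let $\delta>0$ and $M,N\in\mathbb{N}$, and consider the multi-collocation PI-RPNN scheme described in the context for $u'(t)=\lambda u(t)$, $u(t_0)=u_0$, with one-step stability index $S^{(\ell)}$, i.e. $\hat u_\ell=S^{(\ell)}\hat u_{\ell-1}$. In the limit as $\epsilon:=a_Uh^2\to0$ (with $\lambda,h,M,N,\delta$ fixed) the scheme is asymptotically stable almost surely; that is, almost surely the limit of $S^{(\ell)}$ as $\epsilon\to0$ exists and has absolute value strictly less than $1$, so that $|S^{(\ell)}|<1$ whenever the parameter $a_U$ is set such that $\epsilon=a_Uh^2$ is sufficiently small. This holds for all $\lambda h<0$.
   Context: Time is divided into subintervals $[t_{\ell-1},t_\ell]$, $t_\ell=t_{\ell-1}+h$, $\ell\ge1$. On the $\ell$-th subinterval the approximation is $\hat u(t;w)=\hat u_{\ell-1}+(t-t_{\ell-1})\sum_{j=1}^N w_j\phi^{(\ell)}_j(t)$, with $\phi^{(\ell)}_j(t)=\exp(-a_U\theta^{(\ell)}_j(t-\tau^{(\ell)}_j)^2)$, $\tau_j^{(\ell)}=t_{\ell-1}+\frac jNh$, $\theta_1^{(\ell)},\dots,\theta_N^{(\ell)}$ i.i.d. uniform on $[0,1]$, $a_U>0$ a deterministic parameter (which may be chosen depending on $\lambda,h,M$), and $\hat u_0=u_0$. With collocation points $c_i=t_{\ell-1}+\zeta_ih$, $\zeta_i=i/M$, $i=1,\dots,M$, the random weights $w=w^{(\ell)}$ minimize $$\mathbb{E}\Big[\tfrac12\sum_{i=1}^M(\hat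 u'(c_i;w)-\lambda\hat u(c_i;w))^2+\tfrac\delta2\sum_{j=1}^N|w_j|^2\Big],$$ and $\hat u_\ell:=\hat u(t_\ell;w^{(\ell)})$. Equivalently, $\hat u_\ell=S^{(\ell)}\hat u_{\ell-1}$ with the random scalar $$S^{(\ell)}=1+\lambda h\,\Phi^{(\ell)}(t_\ell)^{T}\big(\Psi^{(\ell)}(\Psi^{(\ell)})^{T}+\delta I\big)^{-1}\Psi^{(\ell)}\mathbf{1}_{M\times1},$$ where $\Phi^{(\ell)}(t)=(\phi_1^{(\ell)}(t),\dots,\phi^{(\ell)}_N(t))^T$, $\Psi^{(\ell)}\in\mathbb{R}^{N\times M}$ has entries $\psi^{(\ell)}_{ji}=\phi^{(\ell)}_j(c_i)+(c_i-t_{\ell-1})(\phi^{(\ell)}_j)'(c_i)-\lambda(c_i-t_{\ell-1})\phi^{(\ell)}_j(c_i)$, and $\mathbf 1_{M\times 1}$ is the all-ones vector. The scheme is called asymptotically stable if $|S|<1$ and unstable if $|S|>1$, $S$ being its stability index. *)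

theory Defs
  imports
    "HOL-Probability.Probability"
    "Jordan_Normal_Form.Gauss_Jordan_Elimination"
begin

text \<open>
  Everything up to \<open>stability_index\<close> concerns a single subinterval \<open>[s, s + h]\<close> and a single
  realisation \<open>\<theta> 1, \<dots>, \<theta> N\<close> of its random shape parameters (values of \<open>\<theta>\<close> at other indices are
  irrelevant).  The \<open>l\<close>-th subinterval is the one with \<open>s = grid t0 h (l - 1)\<close>.
\<close>

definition grid :: "real \<Rightarrow> real \<Rightarrow> nat \<Rightarrow> real" where
  "grid t0 h l = t0 + real l * h"

definition rbf_centre :: "real \<Rightarrow> nat \<Rightarrow> real \<Rightarrow> nat \<Rightarrow> real" where
  "rbf_centre h N s j = s + real j / real N * h"

definition colloc_point :: "real \<Rightarrow> nat \<Rightarrow> real \<Rightarrow> nat \<Rightarrow> real" where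
  "colloc_point h M s i = s + real i / real M * h"

definition rbf :: "real \<Rightarrow> nat \<Rightarrow> real \<Rightarrow> real \<Rightarrow> (nat \<Rightarrow> real) \<Rightarrow> nat \<Rightarrow> real \<Rightarrow> real" where
  "rbf h N a s \<theta> j t = exp (- a * \<theta> j * (t - rbf_centre h N s j)\<^sup>2)"

definition ansatz ::
  "real \<Rightarrow> nat \<Rightarrow> real \<Rightarrow> real \<Rightarrow> (nat \<Rightarrow> real) \<Rightarrow> real \<Rightarrow> (nat \<Rightarrow> real) \<Rightarrow> real \<Rightarrow> real" where
  "ansatz h N a s \<theta> uprev w t = uprev + (t - s) * (\<Sum>j=1..N. w j * rbf h N a s \<theta> j t)"

definition colloc_loss ::
  "real \<Rightarrow> real \<Rightarrow> real \<Rightarrow> nat \<Rightarrow> nat \<Rightarrow> real \<Rightarrow> real \<Rightarrow> (nat \<Rightarrow> real) \<Rightarrow> real \<Rightarrow> (nat \<Rightarrow> real) \<Rightarrow> real" where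
  "colloc_loss lam h \<delta> M N a s \<theta> uprev w =
     1/2 * (\<Sum>i=1..M. (deriv (ansatz h N a s \<theta> uprev w) (colloc_point h M s i)
                        - lam * ansatz h N a s \<theta> uprev w (colloc_point h M s i))\<^sup>2)
     + \<delta>/2 * (\<Sum>j=1..N. \<bar>w j\<bar>\<^sup>2)"

text \<open>
  Vectors and matrices are indexed from 0, so entry \<open>j\<close> of a vector (or row \<open>j\<close> of a matrix)
  belongs to the basis function with number \<open>Suc j\<close>, and column \<open>i\<close> to the collocation point with
  number \<open>Suc i\<close>.
\<close>

definition basis_vec :: "real \<Rightarrow> nat \<Rightarrow> real \<Rightarrow> real \<Rightarrow> (nat \<Rightarrow> real) \<Rightarrow> real \<Rightarrow> real Matrix.vec" where
  "basis_vec h N a s \<theta> t = Matrix.vec N (\<lambda>j. rbf h N a s \<theta> (Suc j) t)"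

definition colloc_mat ::
  "real \<Rightarrow> real \<Rightarrow> nat \<Rightarrow> nat \<Rightarrow> real \<Rightarrow> real \<Rightarrow> (nat \<Rightarrow> real) \<Rightarrow> real Matrix.mat" where
  "colloc_mat lam h M N a s \<theta> = Matrix.mat N M (\<lambda>(j, i).
     let c = colloc_point h M s (Suc i) in
       rbf h N a s \<theta> (Suc j) c + (c - s) * deriv (rbf h N a s \<theta> (Suc j)) c
       - lam * (c - s) * rbf h N a s \<theta> (Suc j) c)"

text \<open>
  For \<open>\<delta> > 0\<close> the inverted matrix is positive definite, so \<open>mat_inverse\<close> is never \<open>None\<close> below.
\<close>

definition stability_index ::
  "real \<Rightarrow> real \<Rightarrow> real \<Rightarrow> nat \<Rightarrow> nat \<Rightarrow> real \<Rightarrow> real \<Rightarrow> (nat \<Rightarrow> real) \<Rightarrow> real" where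
  "stability_index lam h \<delta> M N a s \<theta> =
     (let \<Psi> = colloc_mat lam h M N a s \<theta> in
        1 + lam * h *
          scalar_prod (basis_vec h N a s \<theta> (s + h))
            (the (mat_inverse (\<Psi> * transpose_mat \<Psi> + \<delta> \<cdot>\<^sub>m 1\<^sub>m N))
              *\<^sub>v (\<Psi> *\<^sub>v Matrix.vec M (\<lambda>_. 1))))"

definition asymptotically_stable :: "real \<Rightarrow> bool" where
  "asymptotically_stable S \<longleftrightarrow> \<bar>S\<bar> < 1"

text \<open>
  A run of the scheme: \<open>\<theta> l j\<close> are the random shape parameters, \<open>w l j\<close> the random weights and
  \<open>u l\<close> the approximation at \<open>grid t0 h l\<close>.  The loss is nonnegative, so its expectation is taken
  in \<open>[0, \<infinity>]\<close>; the competitors are then all random weight vectors, without any integrability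
  condition.
\<close>

definition random_weights :: "'w measure \<Rightarrow> nat \<Rightarrow> (nat \<Rightarrow> 'w \<Rightarrow> real) \<Rightarrow> bool" where
  "random_weights P N v \<longleftrightarrow> (\<forall>j\<in>{1..N}. v j \<in> borel_measurable P)"

definition expected_loss ::
  "'w measure \<Rightarrow> real \<Rightarrow> real \<Rightarrow> real \<Rightarrow> nat \<Rightarrow> nat \<Rightarrow> real \<Rightarrow> real \<Rightarrow>
   (nat \<Rightarrow> 'w \<Rightarrow> real) \<Rightarrow> ('w \<Rightarrow> real) \<Rightarrow> (nat \<Rightarrow> 'w \<Rightarrow> real) \<Rightarrow> ennreal" where
  "expected_loss P lam h \<delta> M N a s \<theta> uprev v =
     (\<integral>\<^sup>+ \<omega>. ennreal (colloc_loss lam h \<delta> M N a s (\<lambda>j. \<theta> j \<omega>) (uprev \<omega>) (\<lambda>j. v j \<omega>)) \<partial>P)"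

definition rpnn_scheme ::
  "'w measure \<Rightarrow> real \<Rightarrow> real \<Rightarrow> real \<Rightarrow> nat \<Rightarrow> nat \<Rightarrow> real \<Rightarrow> real \<Rightarrow> real \<Rightarrow>
   (nat \<Rightarrow> nat \<Rightarrow> 'w \<Rightarrow> real) \<Rightarrow> (nat \<Rightarrow> nat \<Rightarrow> 'w \<Rightarrow> real) \<Rightarrow> (nat \<Rightarrow> 'w \<Rightarrow> real) \<Rightarrow> bool" where
  "rpnn_scheme P lam h \<delta> M N a t0 u0 \<theta> w u \<longleftrightarrow>
     (\<forall>\<omega>\<in>space P. u 0 \<omega> = u0) \<and>
     (\<forall>l\<ge>1.
        random_weights P N (w l) \<and>
        (\<forall>v. random_weights P N v \<longrightarrow>
           expected_loss P lam h \<delta> M N a (grid t0 h (l - 1)) (\<theta> l) (u (l - 1)) (w l)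
           \<le> expected_loss P lam h \<delta> M N a (grid t0 h (l - 1)) (\<theta> l) (u (l - 1)) v) \<and>
        (\<forall>\<omega>\<in>space P. u l \<omega> =
           ansatz h N a (grid t0 h (l - 1)) (\<lambda>j. \<theta> l j \<omega>) (u (l - 1) \<omega>) (\<lambda>j. w l j \<omega>)
             (grid t0 h l)))"

end

theory Submission
  imports Defs "Jordan_Normal_Form.Determinant"
begin

text \<open>
  The loss of a random weight vector is a pointwise convex quadratic, so a minimizer of its expectation
  solves the normal equations almost surely as soon as the expected loss is finite. Finiteness propagates
  along the grid because the penalty controls the second moment of the weights, and the basis
  functions are bounded by 1.

  As \<open>\<epsilon> \<rightarrow> 0\<close>, the collocation matrix tends to the matrix with all rows equal to
  \<open>b i = 1 + z i/M\<close>, where \<open>z = - \<lambda> h > 0\<close>, uniformly in the shape parameters. The regularized inverse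
  is bounded by \<open>1/\<delta>\<close>, so the index tends to \<open>1 - z N (\<Sum>b) / (N (\<Sum>b\<^sup>2) + \<delta>)\<close>. This exceeds \<open>-1\<close> because
  \<open>2 (\<Sum>b\<^sup>2) - z (\<Sum>b) = 2 M + z (M + 2) + z\<^sup>2 (M + 1) (M + 2) / (6 M) > 0\<close>.
\<close>

section \<open>Regularized normal equations\<close>

text \<open>The Gram form is the squared norm of the transpose of \<open>g\<close> applied to
  \<open>d\<close>. This gives positive semidefiniteness in coordinates.\<close>

lemma sum_gram_eq_sum_squares:
  fixes g :: "nat \<Rightarrow> nat \<Rightarrow> real"
  shows "(\<Sum>j<N. d j * (\<Sum>i<M. (\<Sum>k<N. g k i * d k) * g j i)) = (\<Sum>i<M. (\<Sum>k<N. g k i * d k)\<^sup>2)"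
proof -
  have "(\<Sum>j<N. d j * (\<Sum>i<M. (\<Sum>k<N. g k i * d k) * g j i))
      = (\<Sum>j<N. \<Sum>i<M. (\<Sum>k<N. g k i * d k) * (g j i * d j))"
    by (simp add: sum_distrib_left mult_ac)
  also have "\<dots> = (\<Sum>i<M. \<Sum>j<N. (\<Sum>k<N. g k i * d k) * (g j i * d j))"
    by (rule sum.swap)
  finally show ?thesis
    by (simp add: power2_eq_square sum_distrib_left)
qed

text \<open>Testing the system with \<open>d\<close> and dropping the nonnegative Gram part leaves
  \<open>\<delta>\<close> times the squared norm of \<open>d\<close> below the pairing of
  \<open>d\<close> with \<open>\<rho>\<close>. Young's inequality with weight
  \<open>\<delta>\<close> absorbs half of it. The constant is independent of \<open>g\<close>. The
  bound serves as a uniqueness result when \<open>\<rho>\<close> is 0 and as a stability estimate in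
  the limit.\<close>

lemma regularized_gram_bound:
  fixes g :: "nat \<Rightarrow> nat \<Rightarrow> real"
  assumes "\<delta> > 0"
    and eq: "\<And>j. j < N \<Longrightarrow> (\<Sum>i<M. (\<Sum>k<N. g k i * d k) * g j i) + \<delta> * d j = \<rho> j"
  shows "(\<Sum>j<N. (d j)\<^sup>2) \<le> (\<Sum>j<N. (\<rho> j)\<^sup>2) / \<delta>\<^sup>2"
proof -
  have "(\<Sum>j<N. d j * \<rho> j) = (\<Sum>i<M. (\<Sum>k<N. g k i * d k)\<^sup>2) + \<delta> * (\<Sum>j<N. (d j)\<^sup>2)"
  proof -
    have "(\<Sum>j<N. d j * \<rho> j)
        = (\<Sum>j<N. d j * (\<Sum>i<M. (\<Sum>k<N. g k i * d k) * g j i) + \<delta> * (d j)\<^sup>2)"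
      by (intro sum.cong refl) (simp add: eq[symmetric] algebra_simps power2_eq_square)
    then show ?thesis
      by (simp only: sum.distrib sum_gram_eq_sum_squares sum_distrib_left[symmetric])
  qed
  then have "\<delta> * (\<Sum>j<N. (d j)\<^sup>2) \<le> (\<Sum>j<N. d j * \<rho> j)"
    by (simp add: sum_nonneg)
  also have "\<dots> \<le> (\<Sum>j<N. \<delta> / 2 * (d j)\<^sup>2 + (\<rho> j)\<^sup>2 / (2 * \<delta>))"
  proof (rule sum_mono)
    fix j
    have "0 \<le> (\<delta> * d j - \<rho> j)\<^sup>2 / (2 * \<delta>)"
      using \<open>\<delta> > 0\<close> by simp
    also have "\<dots> = \<delta> / 2 * (d j)\<^sup>2 + (\<rho> j)\<^sup>2 / (2 * \<delta>) - d j * \<rho> j"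
      using \<open>\<delta> > 0\<close> by (simp add: field_simps power2_eq_square)
    finally show "d j * \<rho> j \<le> \<delta> / 2 * (d j)\<^sup>2 + (\<rho> j)\<^sup>2 / (2 * \<delta>)"
      by simp
  qed
  also have "\<dots> = \<delta> / 2 * (\<Sum>j<N. (d j)\<^sup>2) + (\<Sum>j<N. (\<rho> j)\<^sup>2) / (2 * \<delta>)"
    by (simp add: sum.distrib sum_distrib_left sum_divide_distrib)
  finally show ?thesis
    using \<open>\<delta> > 0\<close> by (simp add: field_simps power2_eq_square)
qed

lemma smult_mat_mult_vec:
  fixes A :: "'a :: comm_ring_1 Matrix.mat"
  assumes "A \<in> carrier_mat n m" "v \<in> carrier_vec m"
  shows "(c \<cdot>\<^sub>m A) *\<^sub>v v = c \<cdot>\<^sub>v (A *\<^sub>v v)"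
  using assms by (intro eq_vecI) auto

lemma regularized_gram_mult_vec:
  fixes \<Psi> :: "real Matrix.mat"
  assumes \<Psi>: "\<Psi> \<in> carrier_mat N M" and y: "y \<in> carrier_vec N" and "j < N"
  shows "vec_index ((\<Psi> * transpose_mat \<Psi> + \<delta> \<cdot>\<^sub>m 1\<^sub>m N) *\<^sub>v y) j
    = (\<Sum>i<M. (\<Sum>k<N. \<Psi> $$ (k, i) * vec_index y k) * \<Psi> $$ (j, i)) + \<delta> * vec_index y j"
proof -
  have "(\<Psi> * transpose_mat \<Psi> + \<delta> \<cdot>\<^sub>m 1\<^sub>m N) *\<^sub>v y = \<Psi> *\<^sub>v (transpose_mat \<Psi> *\<^sub>v y) + \<delta> \<cdot>\<^sub>v y"
    using \<Psi> y by (simp add: add_mult_distrib_mat_vec[where nr=N and nc=N]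
        assoc_mult_mat_vec[where ?n\<^sub>1=N and ?n\<^sub>2=M and ?n\<^sub>3=N] smult_mat_mult_vec[where n=N and m=N])
  then show ?thesis
    using \<Psi> y \<open>j < N\<close>
    by (auto simp: scalar_prod_def lessThan_atLeast0 mult_ac intro!: sum.cong)
qed

text \<open>A kernel vector solves the regularized system with zero right-hand side, so the norm
  bound makes it vanish. Hence the determinant is nonzero, and \<open>the\<close> in
  \<open>stability_index\<close> is applied to a genuine inverse.\<close>

lemma mat_inverse_regularized_gram:
  fixes \<Psi> :: "real Matrix.mat"
  assumes \<Psi>: "\<Psi> \<in> carrier_mat N M" and "\<delta> > 0"
  obtains B where "mat_inverse (\<Psi> * transpose_mat \<Psi> + \<delta> \<cdot>\<^sub>m 1\<^sub>m N) = Some B" "B \<in> carrier_mat N N"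
    "(\<Psi> * transpose_mat \<Psi> + \<delta> \<cdot>\<^sub>m 1\<^sub>m N) * B = 1\<^sub>m N"
proof -
  let ?A = "\<Psi> * transpose_mat \<Psi> + \<delta> \<cdot>\<^sub>m 1\<^sub>m N"
  have A: "?A \<in> carrier_mat N N"
    using \<Psi> by simp
  have "det ?A \<noteq> 0"
  proof
    assume "det ?A = 0"
    then obtain v where v: "v \<in> carrier_vec N" "v \<noteq> 0\<^sub>v N" "?A *\<^sub>v v = 0\<^sub>v N"
      using det_0_iff_vec_prod_zero_field[OF A] by blast
    have "(\<Sum>j<N. (vec_index v j)\<^sup>2) \<le> (\<Sum>j<N. 0\<^sup>2) / \<delta>\<^sup>2"
      by (rule regularized_gram_bound[OF \<open>\<delta> > 0\<close>, where M=M and g="\<lambda>j i. \<Psi> $$ (j, i)"])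
        (use v in \<open>simp add: regularized_gram_mult_vec[OF \<Psi> v(1), symmetric] del: index_mult_mat_vec\<close>)
    then have "(\<Sum>j<N. (vec_index v j)\<^sup>2) = 0"
      by (simp add: sum_nonneg order_antisym)
    then have "\<forall>j<N. vec_index v j = 0"
      by (simp add: sum_nonneg_eq_0_iff)
    then show False
      using v by auto
  qed
  then have "?A \<in> Units (ring_mat TYPE(real) N ())"
    by (rule det_non_zero_imp_unit[OF A])
  then obtain B where "mat_inverse ?A = Some B"
    using mat_inverse(1)[OF A] by fastforce
  with mat_inverse(2)[OF A this] that show thesis
    by blast
qed

section \<open>The one-step problem\<close>

lemma deriv_rbf:
  "deriv (rbf h N a s \<theta> j) t = - 2 * a * \<theta> j * (t - rbf_centre h N s j) * rbf h N a s \<theta> j t"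
  unfolding rbf_def by (rule DERIV_imp_deriv) (auto intro!: derivative_eq_intros)

lemma rbf_has_deriv:
  "(rbf h N a s \<theta> j has_real_derivative deriv (rbf h N a s \<theta> j) t) (at t)"
  unfolding deriv_rbf unfolding rbf_def by (auto intro!: derivative_eq_intros)

lemma deriv_ansatz:
  "deriv (ansatz h N a s \<theta> u w) t
   = (\<Sum>j=1..N. w j * (rbf h N a s \<theta> j t + (t - s) * deriv (rbf h N a s \<theta> j) t))"
  unfolding ansatz_def
  by (rule DERIV_imp_deriv)
    (auto intro!: derivative_eq_intros rbf_has_deriv
      simp: sum.distrib sum_distrib_left algebra_simps)

lemma colloc_mat_carrier: "colloc_mat lam h M N a s \<theta> \<in> carrier_mat N M"
  by (simp add: colloc_mat_def)

text \<open>In coordinates scaled by \<open>h\<close> the left endpoint \<open>s\<close> cancels,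
  and \<open>a\<close> enters only through \<open>a * h\<^sup>2\<close>. This makes limits uniform
  in \<open>s\<close> possible and shows measurability in the shape parameters.\<close>

lemma colloc_mat_entry:
  assumes "j < N" "i < M"
  shows "colloc_mat lam h M N a s \<theta> $$ (j, i)
    = (1 - 2 * (a * h\<^sup>2) * \<theta> (Suc j) * (real (Suc i) / real M)
          * (real (Suc i) / real M - real (Suc j) / real N)
        - lam * h * (real (Suc i) / real M))
      * exp (- (a * h\<^sup>2) * \<theta> (Suc j) * (real (Suc i) / real M - real (Suc j) / real N)\<^sup>2)"
proof -
  define p where "p = real (Suc i) / real M"
  define q where "q = real (Suc j) / real N"
  define x where "x = \<theta> (Suc j)"
  define c where "c = colloc_point h M s (Suc i)"
  define E where "E = exp (- (a * h\<^sup>2) * x * (p - q)\<^sup>2)"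
  have c: "c - s = p * h" and d: "c - rbf_centre h N s (Suc j) = h * (p - q)"
    by (simp_all add: c_def colloc_point_def rbf_centre_def p_def q_def algebra_simps)
  have "- a * x * (h * (p - q))\<^sup>2 = - (a * h\<^sup>2) * x * (p - q)\<^sup>2"
    by (simp add: power_mult_distrib mult_ac)
  then have r: "rbf h N a s \<theta> (Suc j) c = E"
    unfolding rbf_def d E_def x_def by simp
  have "colloc_mat lam h M N a s \<theta> $$ (j, i)
      = E + p * h * (- 2 * a * x * (h * (p - q)) * E) - lam * (p * h) * E"
    using assms unfolding colloc_mat_def
    by (simp add: Let_def deriv_rbf c_def[symmetric] c d r x_def[symmetric] del: of_nat_Suc)
  also have "\<dots> = (1 - 2 * (a * h\<^sup>2) * x * p * (p - q) - lam * h * p) * E"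
    by (simp add: algebra_simps power2_eq_square)
  finally show ?thesis
    unfolding p_def q_def x_def E_def .
qed

text \<open>Ridge regression with a single scalar target \<open>c\<close> for all data points: the
  previous value contributes the same \<open>lam * u\<close> to every collocation residual.\<close>

definition ridge_loss :: "nat \<Rightarrow> nat \<Rightarrow> real \<Rightarrow> real \<Rightarrow> (nat \<Rightarrow> nat \<Rightarrow> real) \<Rightarrow> (nat \<Rightarrow> real) \<Rightarrow> real" where
  "ridge_loss M N \<delta> c g x
    = 1/2 * (\<Sum>i<M. ((\<Sum>k<N. g k i * x k) - c)\<^sup>2) + \<delta>/2 * (\<Sum>k<N. (x k)\<^sup>2)"

definition ridge_grad :: "nat \<Rightarrow> nat \<Rightarrow> real \<Rightarrow> real \<Rightarrow> (nat \<Rightarrow> nat \<Rightarrow> real) \<Rightarrow> (nat \<Rightarrow> real) \<Rightarrow> nat \<Rightarrow> real" where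
  "ridge_grad M N \<delta> c g x j = (\<Sum>i<M. ((\<Sum>k<N. g k i * x k) - c) * g j i) + \<delta> * x j"

lemma ridge_loss_nonneg: "\<delta> \<ge> 0 \<Longrightarrow> ridge_loss M N \<delta> c g x \<ge> 0"
  by (simp add: ridge_loss_def sum_nonneg)

text \<open>The ansatz is affine in the weights. Its constant part has zero derivative and leaves
  the target \<open>lam * u\<close>; the linear part has the entries of \<open>colloc_mat\<close> as
  coefficients. The sum over \<open>1..N\<close> is shifted to \<open>{..<N}\<close>.\<close>

lemma colloc_loss_eq_ridge_loss:
  "colloc_loss lam h \<delta> M N a s \<theta> u w
   = ridge_loss M N \<delta> (lam * u) (\<lambda>j i. colloc_mat lam h M N a s \<theta> $$ (j, i)) (\<lambda>j. w (Suc j))"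
proof -
  have "deriv (ansatz h N a s \<theta> u w) c - lam * ansatz h N a s \<theta> u w c
     = (\<Sum>j<N. (rbf h N a s \<theta> (Suc j) c + (c - s) * deriv (rbf h N a s \<theta> (Suc j)) c
         - lam * (c - s) * rbf h N a s \<theta> (Suc j) c) * w (Suc j)) - lam * u" for c
    unfolding deriv_ansatz unfolding ansatz_def One_nat_def sum.atLeast1_atMost_eq
    by (simp add: sum.distrib sum_subtractf sum_distrib_left algebra_simps)
  then show ?thesis
    unfolding colloc_loss_def ridge_loss_def One_nat_def sum.atLeast1_atMost_eq
    by (simp add: colloc_mat_def Let_def)
qed

text \<open>Along coordinate \<open>j\<close> the loss is a parabola with slope
  \<open>ridge_grad\<close> and curvature \<open>K\<close>, so the step to its vertex gains the
  squared slope over \<open>2 * K\<close>. The additive form suits integrals in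
  \<open>ennreal\<close>, where subtraction is awkward.\<close>

lemma ridge_loss_coordinate_step:
  fixes g :: "nat \<Rightarrow> nat \<Rightarrow> real" and x :: "nat \<Rightarrow> real" and \<delta> :: real and M N :: nat
  assumes "j < N" "\<delta> > 0"
  defines "K \<equiv> (\<Sum>i<M. (g j i)\<^sup>2) + \<delta>"
  shows "ridge_loss M N \<delta> c g (x(j := x j - ridge_grad M N \<delta> c g x j / K))
    + (ridge_grad M N \<delta> c g x j)\<^sup>2 / (2 * K) = ridge_loss M N \<delta> c g x"
proof -
  define G where "G = ridge_grad M N \<delta> c g x j"
  have "K > 0"
    using \<open>\<delta> > 0\<close> by (simp add: K_def add_nonneg_pos sum_nonneg)
  have upd: "ridge_loss M N \<delta> c g (x(j := x j + t)) = ridge_loss M N \<delta> c g x + t * G + t\<^sup>2 / 2 * K" for t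
  proof -
    have 1: "(\<Sum>k<N. g k i * (x(j := x j + t)) k) = (\<Sum>k<N. g k i * x k) + t * g j i" for i
    proof -
      have "(\<Sum>k<N. g k i * (x(j := x j + t)) k) = (\<Sum>k<N. g k i * x k + (if k = j then t * g j i else 0))"
        by (intro sum.cong refl) (simp add: algebra_simps)
      then show ?thesis
        using \<open>j < N\<close> by (simp add: sum.distrib)
    qed
    have 2: "(\<Sum>k<N. ((x(j := x j + t)) k)\<^sup>2) = (\<Sum>k<N. (x k)\<^sup>2) + (2 * t * x j + t\<^sup>2)"
    proof -
      have "(\<Sum>k<N. ((x(j := x j + t)) k)\<^sup>2)
          = (\<Sum>k<N. (x k)\<^sup>2 + (if k = j then 2 * t * x j + t\<^sup>2 else 0))"
        by (intro sum.cong refl) (simp add: power2_eq_square algebra_simps)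
      then show ?thesis
        using \<open>j < N\<close> by (simp add: sum.distrib)
    qed
    have 3: "(\<Sum>i<M. ((\<Sum>k<N. g k i * x k) + t * g j i - c)\<^sup>2)
       = (\<Sum>i<M. ((\<Sum>k<N. g k i * x k) - c)\<^sup>2)
         + 2 * t * (\<Sum>i<M. ((\<Sum>k<N. g k i * x k) - c) * g j i) + t\<^sup>2 * (\<Sum>i<M. (g j i)\<^sup>2)"
      unfolding sum_distrib_left sum.distrib[symmetric]
      by (intro sum.cong refl) (simp add: power2_eq_square algebra_simps)
    have 4: "1/2 * (A + 2 * t * B + t\<^sup>2 * C) + \<delta>/2 * (X + (2 * t * x j + t\<^sup>2))
        = 1/2 * A + \<delta>/2 * X + t * (B + \<delta> * x j) + t\<^sup>2 / 2 * (C + \<delta>)" for A B C X :: real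
      by (simp add: algebra_simps)
    show ?thesis
      unfolding ridge_loss_def 1 2 3 G_def ridge_grad_def K_def by (rule 4)
  qed
  have "- (G / K) * G + (- (G / K))\<^sup>2 / 2 * K + G\<^sup>2 / (2 * K) = 0"
    using \<open>K > 0\<close> by (simp add: power2_eq_square field_simps)
  then show ?thesis
    unfolding G_def[symmetric] diff_conv_add_uminus upd by linarith
qed

section \<open>The stability index through the normal equations\<close>

text \<open>Trades the inverse matrix for a solution \<open>y\<close> of the linear system, so that
  all later estimates work with finite sums and \<open>regularized_gram_bound\<close>.\<close>

lemma stability_index_normal_equations:
  fixes lam h \<delta> a s :: real and \<theta> :: "nat \<Rightarrow> real" and M N :: nat
  assumes "\<delta> > 0"
  defines "g \<equiv> \<lambda>j i. colloc_mat lam h M N a s \<theta> $$ (j, i)"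
  shows "\<exists>y. stability_index lam h \<delta> M N a s \<theta>
        = 1 + lam * h * (\<Sum>j<N. rbf h N a s \<theta> (Suc j) (s + h) * y j)
    \<and> (\<forall>j<N. (\<Sum>i<M. (\<Sum>k<N. g k i * y k) * g j i) + \<delta> * y j = (\<Sum>i<M. g j i))"
proof -
  let ?\<Psi> = "colloc_mat lam h M N a s \<theta>"
  let ?A = "?\<Psi> * transpose_mat ?\<Psi> + \<delta> \<cdot>\<^sub>m 1\<^sub>m N"
  let ?r = "?\<Psi> *\<^sub>v Matrix.vec M (\<lambda>_. 1)"
  note \<Psi> = colloc_mat_carrier[of lam h M N a s \<theta>]
  obtain B where B: "mat_inverse ?A = Some B" "B \<in> carrier_mat N N" "?A * B = 1\<^sub>m N"
    using mat_inverse_regularized_gram[OF \<Psi> \<open>\<delta> > 0\<close>] .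
  have A: "?A \<in> carrier_mat N N"
    using \<Psi> by simp
  have r: "?r \<in> carrier_vec N"
    by (rule mult_mat_vec_carrier[OF \<Psi>]) simp
  have y: "B *\<^sub>v ?r \<in> carrier_vec N"
    by (rule mult_mat_vec_carrier[OF B(2) r])
  have "?A *\<^sub>v (B *\<^sub>v ?r) = ?r"
    using assoc_mult_mat_vec[OF A B(2) r] B(3) r by simp
  then have "\<forall>j<N. (\<Sum>i<M. (\<Sum>k<N. g k i * vec_index (B *\<^sub>v ?r) k) * g j i) + \<delta> * vec_index (B *\<^sub>v ?r) j
     = (\<Sum>i<M. g j i)"
    using regularized_gram_mult_vec[OF \<Psi> y, of _ \<delta>] \<Psi>
    by (simp add: g_def scalar_prod_def lessThan_atLeast0 del: index_mult_mat_vec)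
      (simp add: scalar_prod_def)
  moreover have "stability_index lam h \<delta> M N a s \<theta>
      = 1 + lam * h * (\<Sum>j<N. rbf h N a s \<theta> (Suc j) (s + h) * vec_index (B *\<^sub>v ?r) j)"
    using y B(2) unfolding stability_index_def Let_def B(1)
    by (simp add: scalar_prod_def basis_vec_def lessThan_atLeast0)
  ultimately show ?thesis
    by (intro exI[of _ "vec_index (B *\<^sub>v ?r)"] conjI)
qed

text \<open>Vanishing gradient means that the weights solve the same system as \<open>y\<close>,
  with right-hand side scaled by \<open>lam * u\<close>. By uniqueness they equal
  \<open>lam * u * y\<close>, which makes the update linear in \<open>u\<close>.\<close>

lemma stability_index_step:
  fixes lam h \<delta> a s :: real and \<theta> :: "nat \<Rightarrow> real" and M N :: nat
  assumes "\<delta> > 0"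
    and grad: "\<And>j. j < N \<Longrightarrow> ridge_grad M N \<delta> (lam * u)
      (\<lambda>j i. colloc_mat lam h M N a s \<theta> $$ (j, i)) (\<lambda>j. w (Suc j)) j = 0"
  shows "ansatz h N a s \<theta> u w (s + h) = stability_index lam h \<delta> M N a s \<theta> * u"
proof -
  define g where "g = (\<lambda>j i. colloc_mat lam h M N a s \<theta> $$ (j, i))"
  obtain y where S: "stability_index lam h \<delta> M N a s \<theta> = 1 + lam * h * (\<Sum>j<N. rbf h N a s \<theta> (Suc j) (s + h) * y j)"
    and y: "\<And>j. j < N \<Longrightarrow> (\<Sum>i<M. (\<Sum>k<N. g k i * y k) * g j i) + \<delta> * y j = (\<Sum>i<M. g j i)"
    using stability_index_normal_equations[OF \<open>\<delta> > 0\<close>, where lam=lam and h=h and M=M and N=N and a=a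
        and s=s and \<theta>=\<theta>]
    unfolding g_def by auto
  define d where "d j = w (Suc j) - lam * u * y j" for j
  have "(\<Sum>i<M. (\<Sum>k<N. g k i * d k) * g j i) + \<delta> * d j = 0" if "j < N" for j
  proof -
    have "(\<Sum>i<M. (\<Sum>k<N. g k i * d k) * g j i) + \<delta> * d j
      = ridge_grad M N \<delta> (lam * u) g (\<lambda>j. w (Suc j)) j + lam * u * (\<Sum>i<M. g j i)
        - lam * u * ((\<Sum>i<M. (\<Sum>k<N. g k i * y k) * g j i) + \<delta> * y j)"
      by (simp add: ridge_grad_def d_def algebra_simps sum_subtractf sum_distrib_left)
    then show ?thesis
      using y[OF that] grad[OF that] by (simp add: g_def)
  qed
  then have "(\<Sum>j<N. (d j)\<^sup>2) \<le> (\<Sum>j<N. 0\<^sup>2) / \<delta>\<^sup>2"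
    by (intro regularized_gram_bound[OF \<open>\<delta> > 0\<close>, where M=M and g=g]) auto
  then have "(\<Sum>j<N. (d j)\<^sup>2) = 0"
    by (simp add: sum_nonneg order_antisym)
  then have "\<forall>j<N. d j = 0"
    by (simp add: sum_nonneg_eq_0_iff)
  then have "\<forall>j<N. w (Suc j) = lam * u * y j"
    by (simp add: d_def)
  then show ?thesis
    unfolding S ansatz_def One_nat_def sum.atLeast1_atMost_eq
    by (simp add: algebra_simps sum_distrib_left)
qed

section \<open>The limit of vanishing shape parameter\<close>

text \<open>Here \<open>z\<close> plays the role of \<open>- (lam * h)\<close>. The value lies below
  1 because every \<open>b i\<close> is positive; above -1 it is a quadratic inequality in
  \<open>z\<close>, obtained from the closed forms of the power sums.\<close>

lemma limit_index_bound:
  fixes z \<delta> :: real and M N :: nat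
  assumes "z > 0" "\<delta> > 0" "M \<ge> 1" "N \<ge> 1"
  defines "b \<equiv> \<lambda>i. 1 + z * (real (Suc i) / real M)"
  shows "\<bar>1 - z * (real N * ((\<Sum>i<M. b i) / (real N * (\<Sum>i<M. (b i)\<^sup>2) + \<delta>)))\<bar> < 1"
proof -
  have s1: "(\<Sum>i<m. real (Suc i)) = real m * (real m + 1) / 2" for m
    by (induction m) (auto simp: field_simps)
  have s2: "(\<Sum>i<m. (real (Suc i))\<^sup>2) = real m * (real m + 1) * (2 * real m + 1) / 6" for m
    by (induction m) (auto simp: field_simps power2_eq_square)
  have M: "real M > 0" "real M \<ge> 1"
    using \<open>M \<ge> 1\<close> by auto
  have B1: "(\<Sum>i<M. b i) = real M + z * ((real M + 1) / 2)"
  proof -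
    have "(\<Sum>i<M. b i) = (\<Sum>i<M. 1 + z / real M * real (Suc i))"
      by (simp add: b_def)
    also have "\<dots> = real M + z / real M * (\<Sum>i<M. real (Suc i))"
      by (simp only: sum.distrib sum_distrib_left) simp
    also have "\<dots> = real M + z * ((real M + 1) / 2)"
      unfolding s1 using M by (simp add: field_simps)
    finally show ?thesis .
  qed
  have B2: "(\<Sum>i<M. (b i)\<^sup>2) = real M + z * (real M + 1) + z\<^sup>2 * ((real M + 1) * (2 * real M + 1) / (6 * real M))"
  proof -
    have "(\<Sum>i<M. (b i)\<^sup>2) = (\<Sum>i<M. 1 + 2 * z / real M * real (Suc i) + z\<^sup>2 / (real M)\<^sup>2 * (real (Suc i))\<^sup>2)"
      by (intro sum.cong refl) (simp add: b_def power2_eq_square algebra_simps add_divide_distrib)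
    also have "\<dots> = real M + 2 * z / real M * (\<Sum>i<M. real (Suc i)) + z\<^sup>2 / (real M)\<^sup>2 * (\<Sum>i<M. (real (Suc i))\<^sup>2)"
      by (simp only: sum.distrib sum_distrib_left) simp
    also have "\<dots> = real M + z * (real M + 1) + z\<^sup>2 * ((real M + 1) * (2 * real M + 1) / (6 * real M))"
      unfolding s1 s2 using M by (simp add: field_simps power2_eq_square)
    finally show ?thesis .
  qed
  \<comment> \<open>The \<open>z\<^sup>2\<close> coefficients combine through 2 (2 M + 1) - 3 M = M
    + 2, which is positive. All coefficients are therefore positive, and the estimate holds for
    arbitrarily large \<open>z\<close>.\<close>
  have "2 * (\<Sum>i<M. (b i)\<^sup>2) - z * (\<Sum>i<M. b i)
      = 2 * real M + z * (real M + 2) + z\<^sup>2 * ((real M + 1) * (real M + 2) / (6 * real M))"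
    unfolding B1 B2 using M by (simp add: field_simps power2_eq_square)
  also have "\<dots> > 0"
    using M \<open>z > 0\<close> by (intro add_pos_nonneg add_pos_pos) auto
  finally have *: "z * (\<Sum>i<M. b i) < 2 * (\<Sum>i<M. (b i)\<^sup>2)"
    by simp
  have "(\<Sum>i<M. b i) > 0"
    unfolding B1 using M \<open>z > 0\<close> by (simp add: add_pos_pos)
  have N: "real N > 0"
    using \<open>N \<ge> 1\<close> by simp
  have D: "real N * (\<Sum>i<M. (b i)\<^sup>2) + \<delta> > 0"
    using \<open>\<delta> > 0\<close> by (simp add: add_nonneg_pos sum_nonneg)
  \<comment> \<open>The penalty only enlarges the denominator, so the inequality without
    \<open>\<delta>\<close> suffices.\<close>
  have "real N * (z * (\<Sum>i<M. b i)) < 2 * (real N * (\<Sum>i<M. (b i)\<^sup>2) + \<delta>)"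
    using mult_strict_left_mono[OF * N] \<open>\<delta> > 0\<close> by (simp add: algebra_simps)
  then have "z * (real N * ((\<Sum>i<M. b i) / (real N * (\<Sum>i<M. (b i)\<^sup>2) + \<delta>))) < 2"
    using D by (simp add: pos_divide_less_eq mult_ac)
  moreover have "z * (real N * ((\<Sum>i<M. b i) / (real N * (\<Sum>i<M. (b i)\<^sup>2) + \<delta>))) > 0"
    using D N \<open>z > 0\<close> \<open>(\<Sum>i<M. b i) > 0\<close> by simp
  ultimately show ?thesis
    by (simp add: abs_less_iff)
qed

text \<open>Convergence along this filter is convergence as \<open>\<epsilon> \<rightarrow> 0\<close>, uniformly in the left endpoint of
  the subinterval and in the shape parameters.\<close>

definition shape_filter :: "nat \<Rightarrow> (real \<times> real \<times> (nat \<Rightarrow> real)) filter" where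
  "shape_filter N = at_right 0 \<times>\<^sub>F principal (UNIV \<times> {\<theta>. \<forall>j\<in>{1..N}. 0 \<le> \<theta> j \<and> \<theta> j \<le> 1})"

text \<open>Extracts one threshold valid for all endpoints and all admissible parameters at once.
  The theorem needs this because its threshold is chosen before the sample point.\<close>

lemma eventually_shape_filter:
  "eventually P (shape_filter N) \<longleftrightarrow>
   (\<exists>\<epsilon>0>0. \<forall>\<epsilon> s \<theta>. 0 < \<epsilon> \<longrightarrow> \<epsilon> < \<epsilon>0 \<longrightarrow> (\<forall>j\<in>{1..N}. 0 \<le> \<theta> j \<and> \<theta> j \<le> 1) \<longrightarrow> P (\<epsilon>, s, \<theta>))"
proof
  assume "eventually P (shape_filter N)"
  then obtain Pf Pg where Pf: "eventually Pf (at_right 0)"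
    and Pg: "\<forall>y\<in>UNIV \<times> {\<theta>. \<forall>j\<in>{1..N}. 0 \<le> \<theta> j \<and> \<theta> j \<le> 1}. Pg y"
    and PfPg: "\<forall>x y. Pf x \<longrightarrow> Pg y \<longrightarrow> P (x, y)"
    unfolding shape_filter_def eventually_prod_filter eventually_principal by (elim exE conjE)
  obtain \<epsilon>0 where "\<epsilon>0 > 0" "\<forall>\<epsilon>>0. \<epsilon> < \<epsilon>0 \<longrightarrow> Pf \<epsilon>"
    using Pf unfolding eventually_at_right_field by (elim exE conjE)
  then show "\<exists>\<epsilon>0>0. \<forall>\<epsilon> s \<theta>. 0 < \<epsilon> \<longrightarrow> \<epsilon> < \<epsilon>0 \<longrightarrow> (\<forall>j\<in>{1..N}. 0 \<le> \<theta> j \<and> \<theta> j \<le> 1) \<longrightarrow> P (\<epsilon>, s, \<theta>)"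
    using Pg PfPg by (intro exI[of _ \<epsilon>0]) simp
next
  assume "\<exists>\<epsilon>0>0. \<forall>\<epsilon> s \<theta>. 0 < \<epsilon> \<longrightarrow> \<epsilon> < \<epsilon>0 \<longrightarrow> (\<forall>j\<in>{1..N}. 0 \<le> \<theta> j \<and> \<theta> j \<le> 1) \<longrightarrow> P (\<epsilon>, s, \<theta>)"
  then obtain \<epsilon>0 where "\<epsilon>0 > 0"
    and P: "\<forall>\<epsilon> s \<theta>. 0 < \<epsilon> \<longrightarrow> \<epsilon> < \<epsilon>0 \<longrightarrow> (\<forall>j\<in>{1..N}. 0 \<le> \<theta> j \<and> \<theta> j \<le> 1) \<longrightarrow> P (\<epsilon>, s, \<theta>)"
    by (elim exE conjE)
  show "eventually P (shape_filter N)"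
    unfolding shape_filter_def eventually_prod_filter eventually_principal
  proof (intro exI conjI)
    show "eventually (\<lambda>\<epsilon>. 0 < \<epsilon> \<and> \<epsilon> < \<epsilon>0) (at_right (0::real))"
      unfolding eventually_at_right_field using \<open>\<epsilon>0 > 0\<close> by (intro exI[of _ \<epsilon>0]) simp
    show "\<forall>y\<in>UNIV \<times> {\<theta>. \<forall>j\<in>{1..N}. 0 \<le> \<theta> j \<and> \<theta> j \<le> 1}. \<forall>j\<in>{1..N}. 0 \<le> snd y j \<and> snd y j \<le> 1"
      by simp
  qed (use P in simp)
qed

lemma shape_filter_tendsto_bound:
  fixes f :: "real \<times> real \<times> (nat \<Rightarrow> real) \<Rightarrow> real"
  assumes "\<And>\<epsilon> s \<theta>. \<epsilon> > 0 \<Longrightarrow> (\<forall>j\<in>{1..N}. 0 \<le> \<theta> j \<and> \<theta> j \<le> 1) \<Longrightarrow> \<bar>f (\<epsilon>, s, \<theta>) - l\<bar> \<le> C * \<epsilon>"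
  shows "(f \<longlongrightarrow> l) (shape_filter N)"
proof -
  have "filterlim fst (at_right (0::real)) (shape_filter N)"
    unfolding shape_filter_def by (rule filterlim_fst)
  then have "(fst \<longlongrightarrow> (0::real)) (shape_filter N)"
    using filterlim_at by blast
  then have lim: "((\<lambda>p. C * fst p) \<longlongrightarrow> 0) (shape_filter N)"
    by (rule tendsto_mult_right_zero)
  have "eventually (\<lambda>p. norm (f p - l) \<le> C * fst p) (shape_filter N)"
    unfolding eventually_shape_filter using assms by (intro exI[of _ 1]) auto
  then have "((\<lambda>p. f p - l) \<longlongrightarrow> 0) (shape_filter N)"
    by (rule Lim_null_comparison[OF _ lim])
  then show ?thesis
    by (simp add: LIM_zero_iff)
qed

section \<open>Uniform limits of the basis functions and of the collocation matrix\<close>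

lemma one_minus_exp_bound:
  fixes x q \<epsilon> :: real
  assumes "\<epsilon> > 0" "0 \<le> x" "x \<le> 1" "\<bar>q\<bar> \<le> 1"
  shows "\<bar>exp (- \<epsilon> * x * q\<^sup>2) - 1\<bar> \<le> \<epsilon>" "exp (- \<epsilon> * x * q\<^sup>2) \<le> 1"
proof -
  have "q\<^sup>2 \<le> 1"
    using assms by (simp add: abs_square_le_1)
  then have "x * q\<^sup>2 \<le> 1"
    using assms by (simp add: mult_le_one)
  then have "\<epsilon> * (x * q\<^sup>2) \<le> \<epsilon>"
    using assms by (simp add: mult_left_le)
  moreover have "1 + (- \<epsilon> * x * q\<^sup>2) \<le> exp (- \<epsilon> * x * q\<^sup>2)"
    by (rule exp_ge_add_one_self)
  moreover show "exp (- \<epsilon> * x * q\<^sup>2) \<le> 1"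
    using assms by simp
  ultimately show "\<bar>exp (- \<epsilon> * x * q\<^sup>2) - 1\<bar> \<le> \<epsilon>"
    by (simp add: mult.assoc)
qed

lemma rbf_tendsto:
  assumes "j < N" "h > 0"
  shows "((\<lambda>(\<epsilon>, s, \<theta>). rbf h N (\<epsilon> / h\<^sup>2) s \<theta> (Suc j) (s + h)) \<longlongrightarrow> 1) (shape_filter N)"
proof (rule shape_filter_tendsto_bound[where C=1], unfold prod.case)
  fix \<epsilon> s :: real and \<theta> :: "nat \<Rightarrow> real"
  assume *: "\<epsilon> > 0" "\<forall>j\<in>{1..N}. 0 \<le> \<theta> j \<and> \<theta> j \<le> 1"
  have "s + h - rbf_centre h N s (Suc j) = h * (1 - real (Suc j) / real N)"
    by (simp add: rbf_centre_def algebra_simps)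
  then have "rbf h N (\<epsilon> / h\<^sup>2) s \<theta> (Suc j) (s + h) = exp (- \<epsilon> * \<theta> (Suc j) * (1 - real (Suc j) / real N)\<^sup>2)"
    using \<open>h > 0\<close> by (simp add: rbf_def power_mult_distrib)
  moreover have "\<bar>1 - real (Suc j) / real N\<bar> \<le> 1"
    using \<open>j < N\<close> by (simp add: field_simps)
  ultimately show "\<bar>rbf h N (\<epsilon> / h\<^sup>2) s \<theta> (Suc j) (s + h) - 1\<bar> \<le> 1 * \<epsilon>"
    using one_minus_exp_bound(1)[of \<epsilon> "\<theta> (Suc j)"] * \<open>j < N\<close> by simp
qed

lemma colloc_mat_tendsto:
  assumes "j < N" "i < M" "h > 0"
  shows "((\<lambda>(\<epsilon>, s, \<theta>). colloc_mat lam h M N (\<epsilon> / h\<^sup>2) s \<theta> $$ (j, i))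
    \<longlongrightarrow> 1 - lam * h * (real (Suc i) / real M)) (shape_filter N)"
proof (rule shape_filter_tendsto_bound[where C="3 + \<bar>lam * h\<bar>"], unfold prod.case)
  fix \<epsilon> s :: real and \<theta> :: "nat \<Rightarrow> real"
  assume *: "\<epsilon> > 0" "\<forall>j\<in>{1..N}. 0 \<le> \<theta> j \<and> \<theta> j \<le> 1"
  define x where "x = \<theta> (Suc j)"
  define p where "p = real (Suc i) / real M"
  define q where "q = p - real (Suc j) / real N"
  define E where "E = exp (- \<epsilon> * x * q\<^sup>2)"
  have x: "0 \<le> x" "x \<le> 1"
    using * \<open>j < N\<close> by (auto simp: x_def)
  have p: "0 \<le> p" "p \<le> 1"
    using \<open>i < M\<close> by (auto simp: p_def)
  have "0 \<le> real (Suc j) / real N" "real (Suc j) / real N \<le> 1"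
    using \<open>j < N\<close> by auto
  with p have q: "\<bar>q\<bar> \<le> 1"
    unfolding q_def by linarith
  have E: "\<bar>E - 1\<bar> \<le> \<epsilon>" "E \<le> 1" "E > 0"
    using one_minus_exp_bound[OF *(1) x q] by (auto simp: E_def)
  have "colloc_mat lam h M N (\<epsilon> / h\<^sup>2) s \<theta> $$ (j, i) = (1 - 2 * \<epsilon> * x * p * q - lam * h * p) * E"
    using colloc_mat_entry[OF assms(1,2), of lam h "\<epsilon> / h\<^sup>2" s \<theta>] \<open>h > 0\<close>
    by (simp add: x_def p_def q_def E_def)
  then have "colloc_mat lam h M N (\<epsilon> / h\<^sup>2) s \<theta> $$ (j, i) - (1 - lam * h * p)
     = (1 - lam * h * p) * (E - 1) - 2 * \<epsilon> * (x * p * q * E)"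
    by (simp add: algebra_simps)
  also have "\<bar>\<dots>\<bar> \<le> \<bar>1 - lam * h * p\<bar> * \<bar>E - 1\<bar> + 2 * \<epsilon> * \<bar>x * p * q * E\<bar>"
    using abs_triangle_ineq4[of "(1 - lam * h * p) * (E - 1)" "2 * \<epsilon> * (x * p * q * E)"] \<open>\<epsilon> > 0\<close>
    by (simp add: abs_mult)
  \<comment> \<open>The first summand is the error of replacing the Gaussian by 1; the second comes
    from its derivative, with \<open>x\<close>, \<open>p\<close>, \<open>q\<close> and
    \<open>E\<close> all of modulus at most 1. Together they give the constant
    \<open>3 + \<bar>lam * h\<bar>\<close>.\<close>
  also have "\<dots> \<le> (1 + \<bar>lam * h\<bar>) * \<epsilon> + 2 * \<epsilon> * 1"
  proof (intro add_mono mult_mono mult_left_mono)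
    have "\<bar>lam * h * p\<bar> \<le> \<bar>lam * h\<bar>"
      using p by (simp add: abs_mult mult_left_le)
    then show "\<bar>1 - lam * h * p\<bar> \<le> 1 + \<bar>lam * h\<bar>"
      by linarith
    have "\<bar>x * p\<bar> \<le> 1" "\<bar>q * E\<bar> \<le> 1"
      using x p q E by (auto simp: abs_mult intro!: mult_le_one)
    then have "\<bar>(x * p) * (q * E)\<bar> \<le> 1"
      unfolding abs_mult[of "x * p"] by (intro mult_le_one) auto
    then show "\<bar>x * p * q * E\<bar> \<le> 1"
      by (simp add: mult.assoc)
  qed (use * E in auto)
  finally show "\<bar>colloc_mat lam h M N (\<epsilon> / h\<^sup>2) s \<theta> $$ (j, i) - (1 - lam * h * (real (Suc i) / real M))\<bar>
      \<le> (3 + \<bar>lam * h\<bar>) * \<epsilon>"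
    by (simp add: p_def algebra_simps)
qed

text \<open>In the limit all rows coincide, so the system is solved by a constant vector. Instead of
  continuity of matrix inversion, the proof inserts this constant vector into the perturbed system
  and bounds the error by the residual.\<close>

lemma stability_index_tendsto:
  fixes lam h \<delta> :: real and M N :: nat
  assumes "h > 0" "\<delta> > 0"
  defines "b \<equiv> \<lambda>i. 1 - lam * h * (real (Suc i) / real M)"
  shows "((\<lambda>(\<epsilon>, s, \<theta>). stability_index lam h \<delta> M N (\<epsilon> / h\<^sup>2) s \<theta>)
    \<longlongrightarrow> 1 + lam * h * (real N * ((\<Sum>i<M. b i) / (real N * (\<Sum>i<M. (b i)\<^sup>2) + \<delta>)))) (shape_filter N)"
proof -
  \<comment> \<open>The common entry of the limiting solution, from \<open>\<kappa> * (real N *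
    (\<Sum>i<M. (b i)\<^sup>2) + \<delta>) = (\<Sum>i<M. b i)\<close>.\<close>
  define \<kappa> where "\<kappa> = (\<Sum>i<M. b i) / (real N * (\<Sum>i<M. (b i)\<^sup>2) + \<delta>)"
  have D: "real N * (\<Sum>i<M. (b i)\<^sup>2) + \<delta> > 0"
    using \<open>\<delta> > 0\<close> by (simp add: add_nonneg_pos sum_nonneg)
  define g where "g p j i = (case p of (\<epsilon>, s, \<theta>) \<Rightarrow> colloc_mat lam h M N (\<epsilon> / h\<^sup>2) s \<theta> $$ (j, i))" for p j i
  define f where "f p j = (case p of (\<epsilon>, s, \<theta>) \<Rightarrow> rbf h N (\<epsilon> / h\<^sup>2) s \<theta> (Suc j) (s + h))" for p j
  define S where "S p = (case p of (\<epsilon>, s, \<theta>) \<Rightarrow> stability_index lam h \<delta> M N (\<epsilon> / h\<^sup>2) s \<theta>)" for p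
  have "\<forall>p. \<exists>y. S p = 1 + lam * h * (\<Sum>j<N. f p j * y j) \<and>
      (\<forall>j<N. (\<Sum>i<M. (\<Sum>k<N. g p k i * y k) * g p j i) + \<delta> * y j = (\<Sum>i<M. g p j i))"
  proof
    fix p :: "real \<times> real \<times> (nat \<Rightarrow> real)"
    obtain \<epsilon> s \<theta> where "p = (\<epsilon>, s, \<theta>)"
      by (rule prod_cases3)
    then show "\<exists>y. S p = 1 + lam * h * (\<Sum>j<N. f p j * y j) \<and>
      (\<forall>j<N. (\<Sum>i<M. (\<Sum>k<N. g p k i * y k) * g p j i) + \<delta> * y j = (\<Sum>i<M. g p j i))"
      using stability_index_normal_equations[OF \<open>\<delta> > 0\<close>, where lam=lam and h=h and M=M and N=N
          and a="\<epsilon> / h\<^sup>2" and s=s and \<theta>=\<theta>]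
      by (simp add: S_def f_def g_def)
  qed
  \<comment> \<open>Solutions are picked separately for each \<open>p\<close>; their convergence is
    derived from the norm bound alone.\<close>
  from choice[OF this] obtain y where Sy: "\<forall>p. S p = 1 + lam * h * (\<Sum>j<N. f p j * y p j) \<and>
      (\<forall>j<N. (\<Sum>i<M. (\<Sum>k<N. g p k i * y p k) * g p j i) + \<delta> * y p j = (\<Sum>i<M. g p j i))"
    by (elim exE)
  then have S: "S p = 1 + lam * h * (\<Sum>j<N. f p j * y p j)" for p
    by (elim allE conjE)
  have y: "(\<Sum>i<M. (\<Sum>k<N. g p k i * y p k) * g p j i) + \<delta> * y p j = (\<Sum>i<M. g p j i)"
    if "j < N" for p j
    using spec[OF Sy, of p] that by simp
  \<comment> \<open>The residual of the constant vector \<open>\<kappa>\<close> in the system at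
    \<open>p\<close>. It vanishes in the limit by the choice of \<open>\<kappa>\<close>, and it is
    the right-hand side of the system solved by \<open>y p j - \<kappa>\<close>.\<close>
  define \<rho> where "\<rho> p j = (\<Sum>i<M. g p j i) - \<kappa> * ((\<Sum>i<M. (\<Sum>k<N. g p k i) * g p j i) + \<delta>)" for p j
  have g_lim: "((\<lambda>p. g p j i) \<longlongrightarrow> b i) (shape_filter N)" if "j < N" "i < M" for j i
    unfolding g_def b_def using colloc_mat_tendsto[OF that \<open>h > 0\<close>] .
  have \<rho>_lim: "((\<lambda>p. \<rho> p j) \<longlongrightarrow> 0) (shape_filter N)" if "j < N" for j
  proof -
    have "((\<lambda>p. \<rho> p j) \<longlongrightarrow> (\<Sum>i<M. b i) - \<kappa> * ((\<Sum>i<M. (\<Sum>k<N. b i) * b i) + \<delta>)) (shape_filter N)"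
      unfolding \<rho>_def using that by (intro tendsto_intros g_lim) auto
    also have "(\<Sum>i<M. (\<Sum>k<N. b i) * b i) = real N * (\<Sum>i<M. (b i)\<^sup>2)"
      by (simp add: sum_distrib_left power2_eq_square mult.assoc)
    finally show ?thesis
      using D by (simp add: \<kappa>_def)
  qed
  have bound: "(\<Sum>j<N. (y p j - \<kappa>)\<^sup>2) \<le> (\<Sum>j<N. (\<rho> p j)\<^sup>2) / \<delta>\<^sup>2" for p
  proof (rule regularized_gram_bound[OF \<open>\<delta> > 0\<close>, where M=M and g="g p"])
    fix j assume "j < N"
    have "(\<Sum>i<M. (\<Sum>k<N. g p k i * (y p k - \<kappa>)) * g p j i) + \<delta> * (y p j - \<kappa>)
       = ((\<Sum>i<M. (\<Sum>k<N. g p k i * y p k) * g p j i) + \<delta> * y p j)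
         - \<kappa> * ((\<Sum>i<M. (\<Sum>k<N. g p k i) * g p j i) + \<delta>)"
      by (simp add: algebra_simps sum_subtractf sum_distrib_left sum_distrib_right)
    then show "(\<Sum>i<M. (\<Sum>k<N. g p k i * (y p k - \<kappa>)) * g p j i) + \<delta> * (y p j - \<kappa>) = \<rho> p j"
      unfolding y[OF \<open>j < N\<close>] \<rho>_def .
  qed
  have "((\<lambda>p. (\<Sum>j<N. (\<rho> p j)\<^sup>2) / \<delta>\<^sup>2) \<longlongrightarrow> (\<Sum>j<N. 0\<^sup>2) / \<delta>\<^sup>2) (shape_filter N)"
    using \<open>\<delta> > 0\<close> by (intro tendsto_intros \<rho>_lim) auto
  then have lim0: "((\<lambda>p. (\<Sum>j<N. (\<rho> p j)\<^sup>2) / \<delta>\<^sup>2) \<longlongrightarrow> 0) (shape_filter N)"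
    by simp
  have y_lim: "((\<lambda>p. y p j) \<longlongrightarrow> \<kappa>) (shape_filter N)" if "j < N" for j
  proof -
    have "(y p j - \<kappa>)\<^sup>2 \<le> (\<Sum>j<N. (y p j - \<kappa>)\<^sup>2)" for p
      using that by (intro member_le_sum) auto
    from order_trans[OF this bound]
    have "norm ((y p j - \<kappa>)\<^sup>2) \<le> (\<Sum>j<N. (\<rho> p j)\<^sup>2) / \<delta>\<^sup>2" for p
      by simp
    then have "((\<lambda>p. (y p j - \<kappa>)\<^sup>2) \<longlongrightarrow> 0) (shape_filter N)"
      by (intro Lim_null_comparison[OF _ lim0]) simp
    from tendsto_real_sqrt[OF this] have "((\<lambda>p. y p j - \<kappa>) \<longlongrightarrow> 0) (shape_filter N)"
      by (simp add: tendsto_rabs_zero_iff)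
    then show ?thesis
      by (simp add: LIM_zero_iff)
  qed
  have "(S \<longlongrightarrow> 1 + lam * h * (\<Sum>j<N. 1 * \<kappa>)) (shape_filter N)"
    unfolding S[abs_def] f_def
    using rbf_tendsto[OF _ \<open>h > 0\<close>] by (intro tendsto_intros y_lim) auto
  then show ?thesis
    by (simp add: S_def[abs_def] \<kappa>_def)
qed

section \<open>Minimizers of the expected loss\<close>

lemma measurable_colloc_mat:
  assumes "\<And>j. j \<in> {1..N} \<Longrightarrow> \<theta> j \<in> borel_measurable P" and "j < N" "i < M"
  shows "(\<lambda>\<omega>. colloc_mat lam h M N a s (\<lambda>j. \<theta> j \<omega>) $$ (j, i)) \<in> borel_measurable P"
proof -
  have [measurable]: "\<theta> (Suc j) \<in> borel_measurable P"
    using assms by simp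
  show ?thesis
    unfolding colloc_mat_entry[OF assms(2,3)] by measurable
qed

lemma measurable_ridge_loss:
  assumes "\<And>k i. k < N \<Longrightarrow> i < M \<Longrightarrow> (\<lambda>\<omega>. g \<omega> k i) \<in> borel_measurable P"
    and "c \<in> borel_measurable P" and "\<And>k. k < N \<Longrightarrow> (\<lambda>\<omega>. x \<omega> k) \<in> borel_measurable P"
  shows "(\<lambda>\<omega>. ridge_loss M N \<delta> (c \<omega>) (g \<omega>) (x \<omega>)) \<in> borel_measurable P"
  unfolding ridge_loss_def using assms
  by (intro borel_measurable_add borel_measurable_times borel_measurable_sum borel_measurable_power
      borel_measurable_diff borel_measurable_const) auto

lemma measurable_ridge_grad:
  assumes "\<And>k i. k < N \<Longrightarrow> i < M \<Longrightarrow> (\<lambda>\<omega>. g \<omega> k i) \<in> borel_measurable P"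
    and "c \<in> borel_measurable P" and "\<And>k. k < N \<Longrightarrow> (\<lambda>\<omega>. x \<omega> k) \<in> borel_measurable P" and "j < N"
  shows "(\<lambda>\<omega>. ridge_grad M N \<delta> (c \<omega>) (g \<omega>) (x \<omega>) j) \<in> borel_measurable P"
  unfolding ridge_grad_def using assms
  by (intro borel_measurable_add borel_measurable_times borel_measurable_sum borel_measurable_power
      borel_measurable_diff borel_measurable_const) auto

lemma measurable_colloc_loss:
  assumes "\<And>j. j \<in> {1..N} \<Longrightarrow> \<theta> j \<in> borel_measurable P" and "u \<in> borel_measurable P"
    and "random_weights P N v"
  shows "(\<lambda>\<omega>. colloc_loss lam h \<delta> M N a s (\<lambda>j. \<theta> j \<omega>) (u \<omega>) (\<lambda>j. v j \<omega>)) \<in> borel_measurable P"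
  unfolding colloc_loss_eq_ridge_loss
  using assms by (intro measurable_ridge_loss measurable_colloc_mat borel_measurable_times
      borel_measurable_const) (auto simp: random_weights_def)

lemma colloc_loss_nonneg: "\<delta> \<ge> 0 \<Longrightarrow> colloc_loss lam h \<delta> M N a s \<theta> u w \<ge> 0"
  by (simp add: colloc_loss_eq_ridge_loss ridge_loss_nonneg)

text \<open>An exact coordinate-wise minimization step lowers the loss pointwise by a multiple of the squared
  partial derivative, and it keeps the weights measurable.\<close>

lemma expected_loss_minimizer_grad:
  assumes "\<delta> > 0"
    and \<theta>: "\<And>j. j \<in> {1..N} \<Longrightarrow> \<theta> j \<in> borel_measurable P"
    and u: "u \<in> borel_measurable P"
    and w: "random_weights P N w"
    and min: "\<And>v. random_weights P N v \<Longrightarrow>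
      expected_loss P lam h \<delta> M N a s \<theta> u w \<le> expected_loss P lam h \<delta> M N a s \<theta> u v"
    and fin: "expected_loss P lam h \<delta> M N a s \<theta> u w < \<infinity>"
  shows "AE \<omega> in P. \<forall>j<N. ridge_grad M N \<delta> (lam * u \<omega>)
    (\<lambda>j i. colloc_mat lam h M N a s (\<lambda>j. \<theta> j \<omega>) $$ (j, i)) (\<lambda>j. w (Suc j) \<omega>) j = 0"
proof -
  define g where "g \<omega> = (\<lambda>j i. colloc_mat lam h M N a s (\<lambda>j. \<theta> j \<omega>) $$ (j, i))" for \<omega>
  define L where "L v \<omega> = colloc_loss lam h \<delta> M N a s (\<lambda>j. \<theta> j \<omega>) (u \<omega>) (\<lambda>j. v j \<omega>)" for v \<omega>
  have g [measurable]: "(\<lambda>\<omega>. g \<omega> k i) \<in> borel_measurable P" if "k < N" "i < M" for k i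
    unfolding g_def using that by (intro measurable_colloc_mat \<theta>)
  have "AE \<omega> in P. ridge_grad M N \<delta> (lam * u \<omega>) (g \<omega>) (\<lambda>j. w (Suc j) \<omega>) j = 0" if "j < N" for j
  proof -
    define G where "G \<omega> = ridge_grad M N \<delta> (lam * u \<omega>) (g \<omega>) (\<lambda>j. w (Suc j) \<omega>) j" for \<omega>
    define K where "K \<omega> = (\<Sum>i<M. (g \<omega> j i)\<^sup>2) + \<delta>" for \<omega>
    \<comment> \<open>The competitor takes the vertex step in one coordinate, at each sample point.
      Coordinate \<open>j\<close> of the ridge problem is weight number
      \<open>Suc j\<close>.\<close>
    define v where "v = (\<lambda>k \<omega>. if k = Suc j then w k \<omega> - G \<omega> / K \<omega> else w k \<omega>)"
    have [measurable]: "G \<in> borel_measurable P"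
      unfolding G_def[abs_def] using that w u
      by (intro measurable_ridge_grad g borel_measurable_times borel_measurable_const)
        (auto simp: random_weights_def)
    have [measurable]: "K \<in> borel_measurable P"
      unfolding K_def[abs_def] using that
      by (intro borel_measurable_add borel_measurable_sum borel_measurable_power g
          borel_measurable_const) auto
    have K: "K \<omega> > 0" for \<omega>
      using \<open>\<delta> > 0\<close> by (simp add: K_def add_nonneg_pos sum_nonneg)
    have v: "random_weights P N v"
      using w unfolding random_weights_def v_def by auto
    have step: "L v \<omega> + (G \<omega>)\<^sup>2 / (2 * K \<omega>) = L w \<omega>" for \<omega>
    proof -
      have "(\<lambda>k. v (Suc k) \<omega>) = (\<lambda>k. w (Suc k) \<omega>)(j := w (Suc j) \<omega> - G \<omega> / K \<omega>)"
        by (auto simp: v_def)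
      then show ?thesis
        using ridge_loss_coordinate_step[OF that \<open>\<delta> > 0\<close>, of M "lam * u \<omega>" "g \<omega>" "\<lambda>k. w (Suc k) \<omega>"]
        by (simp add: L_def colloc_loss_eq_ridge_loss g_def[symmetric] G_def[symmetric] K_def[symmetric])
    qed
    have [measurable]: "L v \<in> borel_measurable P"
      unfolding L_def[abs_def] using \<theta> u v by (rule measurable_colloc_loss)
    have "(\<integral>\<^sup>+ \<omega>. ennreal (L v \<omega>) \<partial>P) + (\<integral>\<^sup>+ \<omega>. ennreal ((G \<omega>)\<^sup>2 / (2 * K \<omega>)) \<partial>P)
        = (\<integral>\<^sup>+ \<omega>. ennreal (L v \<omega>) + ennreal ((G \<omega>)\<^sup>2 / (2 * K \<omega>)) \<partial>P)"
      by (rule nn_integral_add[symmetric]) measurable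
    also have "\<dots> = (\<integral>\<^sup>+ \<omega>. ennreal (L w \<omega>) \<partial>P)"
    proof (rule nn_integral_cong)
      fix \<omega>
      have "L v \<omega> \<ge> 0" "(G \<omega>)\<^sup>2 / (2 * K \<omega>) \<ge> 0"
        using \<open>\<delta> > 0\<close> K[of \<omega>] by (auto simp: L_def colloc_loss_nonneg)
      then show "ennreal (L v \<omega>) + ennreal ((G \<omega>)\<^sup>2 / (2 * K \<omega>)) = ennreal (L w \<omega>)"
        by (simp flip: step ennreal_plus)
    qed
    finally have sum: "(\<integral>\<^sup>+ \<omega>. ennreal (L v \<omega>) \<partial>P) + (\<integral>\<^sup>+ \<omega>. ennreal ((G \<omega>)\<^sup>2 / (2 * K \<omega>)) \<partial>P)
        = (\<integral>\<^sup>+ \<omega>. ennreal (L w \<omega>) \<partial>P)" .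
    have le: "(\<integral>\<^sup>+ \<omega>. ennreal (L w \<omega>) \<partial>P) \<le> (\<integral>\<^sup>+ \<omega>. ennreal (L v \<omega>) \<partial>P)"
      and "(\<integral>\<^sup>+ \<omega>. ennreal (L w \<omega>) \<partial>P) < \<infinity>"
      using min[OF v] fin by (auto simp: expected_loss_def L_def)
    \<comment> \<open>Cancellation in \<open>ennreal\<close> requires a finite summand; this is
      where \<open>fin\<close> enters. Minimality then forces the integrated gain to be 0.\<close>
    then have "(\<integral>\<^sup>+ \<omega>. ennreal (L v \<omega>) \<partial>P) \<noteq> \<infinity>"
      using sum by auto
    moreover have "(\<integral>\<^sup>+ \<omega>. ennreal (L v \<omega>) \<partial>P) + (\<integral>\<^sup>+ \<omega>. ennreal ((G \<omega>)\<^sup>2 / (2 * K \<omega>)) \<partial>P)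
        \<le> (\<integral>\<^sup>+ \<omega>. ennreal (L v \<omega>) \<partial>P) + 0"
      unfolding sum using le by simp
    ultimately have "(\<integral>\<^sup>+ \<omega>. ennreal ((G \<omega>)\<^sup>2 / (2 * K \<omega>)) \<partial>P) \<le> 0"
      unfolding ennreal_add_left_cancel_le by auto
    then have "(\<integral>\<^sup>+ \<omega>. ennreal ((G \<omega>)\<^sup>2 / (2 * K \<omega>)) \<partial>P) = 0"
      by simp
    then have "AE \<omega> in P. ennreal ((G \<omega>)\<^sup>2 / (2 * K \<omega>)) = 0"
      by (subst (asm) nn_integral_0_iff_AE) auto
    then show ?thesis
    proof (rule AE_mp, intro AE_I2 impI)
      fix \<omega> assume "ennreal ((G \<omega>)\<^sup>2 / (2 * K \<omega>)) = 0"
      then have "(G \<omega>)\<^sup>2 / (2 * K \<omega>) \<le> 0"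
        by (simp only: ennreal_eq_0_iff)
      then show "ridge_grad M N \<delta> (lam * u \<omega>) (g \<omega>) (\<lambda>j. w (Suc j) \<omega>) j = 0"
        using K[of \<omega>] by (simp add: G_def[symmetric] divide_le_0_iff)
    qed
  qed
  then have "AE \<omega> in P. \<forall>j\<in>{..<N}. ridge_grad M N \<delta> (lam * u \<omega>) (g \<omega>) (\<lambda>j. w (Suc j) \<omega>) j = 0"
    by (intro AE_finite_allI) auto
  then show ?thesis
    by (simp add: g_def Ball_def)
qed

section \<open>Square integrability along the grid\<close>

lemma expected_loss_zero_weights_finite:
  assumes "\<delta> \<ge> 0" "integrable P (\<lambda>\<omega>. (u \<omega>)\<^sup>2)"
  shows "expected_loss P lam h \<delta> M N a s \<theta> u (\<lambda>_ _. 0) < \<infinity>"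
proof -
  \<comment> \<open>With zero weights the ansatz is constant, so each of the \<open>M\<close>
    residuals is \<open>- lam * u\<close> and the penalty vanishes.\<close>
  have "colloc_loss lam h \<delta> M N a s \<theta>' (u \<omega>) (\<lambda>_. 0) = real M / 2 * lam\<^sup>2 * (u \<omega>)\<^sup>2" for \<theta>' \<omega>
    by (simp add: colloc_loss_eq_ridge_loss ridge_loss_def power_mult_distrib)
  then have "expected_loss P lam h \<delta> M N a s \<theta> u (\<lambda>_ _. 0)
      = (\<integral>\<^sup>+ \<omega>. ennreal (real M / 2 * lam\<^sup>2 * (u \<omega>)\<^sup>2) \<partial>P)"
    by (simp only: expected_loss_def)
  also have "\<dots> = ennreal (\<integral>\<omega>. real M / 2 * lam\<^sup>2 * (u \<omega>)\<^sup>2 \<partial>P)"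
    using assms by (intro nn_integral_eq_integral) auto
  finally show ?thesis
    by simp
qed

text \<open>The basis functions are at most 1 since \<open>a * \<theta> j\<close> is nonnegative,
  and the penalty bounds the sum of squared weights by \<open>2 / \<delta>\<close> times the loss.
  Cauchy-Schwarz supplies the factor \<open>real N\<close>, and splitting the square of the update
  supplies the remaining factor 2.\<close>

lemma ansatz_square_bound:
  assumes "\<delta> > 0" "a > 0" "\<forall>j\<in>{1..N}. 0 \<le> \<theta> j"
  shows "(ansatz h N a s \<theta> u w (s + h))\<^sup>2
    \<le> 2 * u\<^sup>2 + 4 * h\<^sup>2 * real N / \<delta> * colloc_loss lam h \<delta> M N a s \<theta> u w"
proof -
  define x where "x j = w j * rbf h N a s \<theta> j (s + h)" for j
  have "(x j)\<^sup>2 \<le> (w j)\<^sup>2" if "j \<in> {1..N}" for j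
  proof -
    have "\<bar>rbf h N a s \<theta> j (s + h)\<bar> \<le> 1"
      using assms that by (simp add: rbf_def)
    then have "\<bar>x j\<bar> \<le> \<bar>w j\<bar>"
      by (simp add: x_def abs_mult mult_left_le)
    then show ?thesis
      by (simp add: abs_le_square_iff)
  qed
  then have "(\<Sum>j=1..N. (x j)\<^sup>2) \<le> (\<Sum>j=1..N. \<bar>w j\<bar>\<^sup>2)"
    by (auto intro: sum_mono)
  also have "\<dots> \<le> 2 / \<delta> * colloc_loss lam h \<delta> M N a s \<theta> u w"
    using \<open>\<delta> > 0\<close> by (simp add: colloc_loss_def field_simps sum_nonneg)
  finally have 1: "(\<Sum>j=1..N. (x j)\<^sup>2) \<le> 2 / \<delta> * colloc_loss lam h \<delta> M N a s \<theta> u w" .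
  have "(\<Sum>j=1..N. x j)\<^sup>2 \<le> real N * (\<Sum>j=1..N. (x j)\<^sup>2)"
    using sum_squared_le_sum_of_squares[of x "{1..N}"] by (simp add: mult.commute)
  also have "\<dots> \<le> real N * (2 / \<delta> * colloc_loss lam h \<delta> M N a s \<theta> u w)"
    by (intro mult_left_mono 1) simp
  finally have 2: "(\<Sum>j=1..N. x j)\<^sup>2 \<le> real N * (2 / \<delta> * colloc_loss lam h \<delta> M N a s \<theta> u w)" .
  have "(ansatz h N a s \<theta> u w (s + h))\<^sup>2 = (u + h * (\<Sum>j=1..N. x j))\<^sup>2"
    by (simp add: ansatz_def x_def)
  also have "\<dots> \<le> 2 * u\<^sup>2 + 2 * h\<^sup>2 * (\<Sum>j=1..N. x j)\<^sup>2"
    using zero_le_power2[of "u - h * (\<Sum>j=1..N. x j)"]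
    by (simp add: power2_sum power2_diff power_mult_distrib)
  also have "\<dots> \<le> 2 * u\<^sup>2 + 2 * h\<^sup>2 * (real N * (2 / \<delta> * colloc_loss lam h \<delta> M N a s \<theta> u w))"
    by (intro add_left_mono mult_left_mono 2) simp
  finally show ?thesis
    by (simp add: algebra_simps)
qed

lemma measurable_ansatz:
  assumes "\<And>j. j \<in> {1..N} \<Longrightarrow> \<theta> j \<in> borel_measurable P" and [measurable]: "u \<in> borel_measurable P"
    and "random_weights P N w"
  shows "(\<lambda>\<omega>. ansatz h N a s (\<lambda>j. \<theta> j \<omega>) (u \<omega>) (\<lambda>j. w j \<omega>) t) \<in> borel_measurable P"
proof -
  have "(\<lambda>\<omega>. w j \<omega> * exp (- a * \<theta> j \<omega> * (t - rbf_centre h N s j)\<^sup>2)) \<in> borel_measurable P"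
    if "j \<in> {1..N}" for j
  proof -
    have [measurable]: "\<theta> j \<in> borel_measurable P" "w j \<in> borel_measurable P"
      using assms that by (auto simp: random_weights_def)
    show ?thesis
      by measurable
  qed
  then have [measurable]: "(\<lambda>\<omega>. \<Sum>j=1..N. w j \<omega> * exp (- a * \<theta> j \<omega> * (t - rbf_centre h N s j)\<^sup>2))
      \<in> borel_measurable P"
    by (rule borel_measurable_sum)
  show ?thesis
    unfolding ansatz_def rbf_def by measurable
qed

lemma integrable_ansatz_square:
  assumes "\<delta> > 0" "a > 0"
    and \<theta>: "\<And>j. j \<in> {1..N} \<Longrightarrow> \<theta> j \<in> borel_measurable P"
    and AE_\<theta>: "AE \<omega> in P. \<forall>j\<in>{1..N}. 0 \<le> \<theta> j \<omega>"
    and u: "u \<in> borel_measurable P" "integrable P (\<lambda>\<omega>. (u \<omega>)\<^sup>2)"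
    and w: "random_weights P N w"
    and fin: "expected_loss P lam h \<delta> M N a s \<theta> u w < \<infinity>"
  shows "integrable P (\<lambda>\<omega>. (ansatz h N a s (\<lambda>j. \<theta> j \<omega>) (u \<omega>) (\<lambda>j. w j \<omega>) (s + h))\<^sup>2)"
proof (rule Bochner_Integration.integrable_bound)
  let ?L = "\<lambda>\<omega>. colloc_loss lam h \<delta> M N a s (\<lambda>j. \<theta> j \<omega>) (u \<omega>) (\<lambda>j. w j \<omega>)"
  have "integrable P ?L"
    using fin \<open>\<delta> > 0\<close> measurable_colloc_loss[OF \<theta> u(1) w]
    by (intro integrableI_nonneg) (auto simp: expected_loss_def colloc_loss_nonneg)
  then show "integrable P (\<lambda>\<omega>. 2 * (u \<omega>)\<^sup>2 + 4 * h\<^sup>2 * real N / \<delta> * ?L \<omega>)"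
    using u by simp
  show "(\<lambda>\<omega>. (ansatz h N a s (\<lambda>j. \<theta> j \<omega>) (u \<omega>) (\<lambda>j. w j \<omega>) (s + h))\<^sup>2) \<in> borel_measurable P"
    by (intro borel_measurable_power measurable_ansatz \<theta> u w)
  show "AE \<omega> in P. norm ((ansatz h N a s (\<lambda>j. \<theta> j \<omega>) (u \<omega>) (\<lambda>j. w j \<omega>) (s + h))\<^sup>2)
      \<le> norm (2 * (u \<omega>)\<^sup>2 + 4 * h\<^sup>2 * real N / \<delta> * ?L \<omega>)"
    using AE_\<theta>
  proof (rule AE_mp, intro AE_I2 impI)
    fix \<omega> assume "\<forall>j\<in>{1..N}. 0 \<le> \<theta> j \<omega>"
    from ansatz_square_bound[OF \<open>\<delta> > 0\<close> \<open>a > 0\<close> this]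
    show "norm ((ansatz h N a s (\<lambda>j. \<theta> j \<omega>) (u \<omega>) (\<lambda>j. w j \<omega>) (s + h))\<^sup>2)
      \<le> norm (2 * (u \<omega>)\<^sup>2 + 4 * h\<^sup>2 * real N / \<delta> * ?L \<omega>)"
      by (simp add: abs_le_iff order_trans[OF _ abs_ge_self])
  qed
qed

lemma (in prob_space) AE_uniform_unit_interval:
  assumes "random_variable borel X" "distr M borel X = uniform_measure lborel {0..1::real}"
  shows "AE \<omega> in M. 0 \<le> X \<omega> \<and> X \<omega> \<le> 1"
proof -
  have "AE x in distr M borel X. 0 \<le> x \<and> x \<le> 1"
    unfolding assms(2) by (rule AE_uniform_measureI) auto
  then show ?thesis
    by (rule AE_distrD[OF assms(1)])
qed

text \<open>If all competitors had infinite expected loss, minimality would carry no information. By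
  induction, the zero weights have finite expected loss, hence so does the minimizer, and
  \<open>ansatz_square_bound\<close> passes the second moment on to the next grid point.\<close>

lemma rpnn_scheme_square_integrable:
  fixes \<theta> :: "nat \<Rightarrow> nat \<Rightarrow> 'w \<Rightarrow> real"
  assumes "prob_space P" "\<delta> > 0" "a > 0"
    and \<theta>: "\<And>l j. l \<ge> 1 \<Longrightarrow> j \<in> {1..N} \<Longrightarrow> \<theta> l j \<in> borel_measurable P"
    and AE_\<theta>: "\<And>l. l \<ge> 1 \<Longrightarrow> AE \<omega> in P. \<forall>j\<in>{1..N}. 0 \<le> \<theta> l j \<omega>"
    and scheme: "rpnn_scheme P lam h \<delta> M N a t0 u0 \<theta> w u"
  shows "u l \<in> borel_measurable P \<and> integrable P (\<lambda>\<omega>. (u l \<omega>)\<^sup>2)"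
proof (induction l)
  case 0
  interpret prob_space P by fact
  have "u 0 \<omega> = u0" if "\<omega> \<in> space P" for \<omega>
    using scheme that by (simp add: rpnn_scheme_def)
  note u0 = this
  \<comment> \<open>The scheme prescribes \<open>u\<close> only on \<open>space P\<close>, so both
    properties are transferred by congruence there.\<close>
  have "u 0 \<in> borel_measurable P \<longleftrightarrow> (\<lambda>_. u0) \<in> borel_measurable P"
    by (rule measurable_cong) (rule u0)
  moreover have "integrable P (\<lambda>\<omega>. (u 0 \<omega>)\<^sup>2) \<longleftrightarrow> integrable P (\<lambda>_. u0\<^sup>2)"
    by (rule Bochner_Integration.integrable_cong) (simp_all add: u0)
  ultimately show ?case
    by simp
next
  case (Suc l)
  let ?s = "grid t0 h l"
  have w: "random_weights P N (w (Suc l))"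
    and min: "expected_loss P lam h \<delta> M N a ?s (\<theta> (Suc l)) (u l) (w (Suc l))
      \<le> expected_loss P lam h \<delta> M N a ?s (\<theta> (Suc l)) (u l) (\<lambda>_ _. 0)"
    and upd: "\<And>\<omega>. \<omega> \<in> space P \<Longrightarrow> u (Suc l) \<omega> = ansatz h N a ?s (\<lambda>j. \<theta> (Suc l) j \<omega>) (u l \<omega>)
      (\<lambda>j. w (Suc l) j \<omega>) (?s + h)"
    using scheme by (auto simp: rpnn_scheme_def random_weights_def grid_def algebra_simps dest!: spec[of _ "Suc l"])
  have fin: "expected_loss P lam h \<delta> M N a ?s (\<theta> (Suc l)) (u l) (w (Suc l)) < \<infinity>"
    using min expected_loss_zero_weights_finite[of \<delta> P "u l" lam h M N a ?s "\<theta> (Suc l)"] Suc.IH \<open>\<delta> > 0\<close>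
    by (auto intro: le_less_trans)
  let ?f = "\<lambda>\<omega>. ansatz h N a ?s (\<lambda>j. \<theta> (Suc l) j \<omega>) (u l \<omega>) (\<lambda>j. w (Suc l) j \<omega>) (?s + h)"
  have "?f \<in> borel_measurable P"
    using Suc.IH by (intro measurable_ansatz \<theta> w) auto
  moreover have "integrable P (\<lambda>\<omega>. (?f \<omega>)\<^sup>2)"
    using Suc.IH
    by (intro integrable_ansatz_square[OF \<open>\<delta> > 0\<close> \<open>a > 0\<close> _ _ _ _ w fin] \<theta> AE_\<theta>) auto
  moreover have "u (Suc l) \<in> borel_measurable P \<longleftrightarrow> ?f \<in> borel_measurable P"
    by (rule measurable_cong) (rule upd)
  moreover have "integrable P (\<lambda>\<omega>. (u (Suc l) \<omega>)\<^sup>2) \<longleftrightarrow> integrable P (\<lambda>\<omega>. (?f \<omega>)\<^sup>2)"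
    by (rule Bochner_Integration.integrable_cong) (simp_all add: upd)
  ultimately show ?case
    by blast
qed

text \<open>The first conjunct ties the closed formula to the scheme defined by minimization. In the
  last one the threshold precedes the almost sure quantifier, so it is deterministic and shared by
  all subintervals.\<close>

theorem theorem3p1:
  fixes P :: "'w measure"
    and \<theta> :: "nat \<Rightarrow> nat \<Rightarrow> 'w \<Rightarrow> real"
    and lam h \<delta> t0 u0 :: real
    and M N :: nat
  assumes "prob_space P"
    and "h > 0" and "lam * h < 0" and "\<delta> > 0" and "M \<ge> 1" and "N \<ge> 1"
    and indep: "\<And>l. l \<ge> 1 \<Longrightarrow> prob_space.indep_vars P (\<lambda>_. borel) (\<theta> l) {1..N}"
    and unif: "\<And>l j. l \<ge> 1 \<Longrightarrow> j \<in> {1..N} \<Longrightarrow>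
                 distr P borel (\<theta> l j) = uniform_measure lborel {0..1}"
  shows
    "(\<forall>a>0. \<forall>w u. rpnn_scheme P lam h \<delta> M N a t0 u0 \<theta> w u \<longrightarrow>
        (\<forall>l\<ge>1. AE \<omega> in P. u l \<omega> =
           stability_index lam h \<delta> M N a (grid t0 h (l - 1)) (\<lambda>j. \<theta> l j \<omega>) * u (l - 1) \<omega>)) \<and>
     (AE \<omega> in P. \<forall>l\<ge>1. \<exists>L.
        ((\<lambda>\<epsilon>. stability_index lam h \<delta> M N (\<epsilon> / h\<^sup>2) (grid t0 h (l - 1)) (\<lambda>j. \<theta> l j \<omega>)) \<longlongrightarrow> L)
          (at_right 0) \<and> \<bar>L\<bar> < 1) \<and>
     (\<exists>\<epsilon>0>0. AE \<omega> in P. \<forall>a>0. a * h\<^sup>2 < \<epsilon>0 \<longrightarrow>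
        (\<forall>l\<ge>1. asymptotically_stable
           (stability_index lam h \<delta> M N a (grid t0 h (l - 1)) (\<lambda>j. \<theta> l j \<omega>))))"
proof (intro conjI allI impI)
  interpret prob_space P by fact
  have \<theta>: "\<theta> l j \<in> borel_measurable P" if "l \<ge> 1" "j \<in> {1..N}" for l j
    using indep[OF \<open>l \<ge> 1\<close>] that by (simp add: indep_vars_def)
  have AE_\<theta>: "AE \<omega> in P. \<forall>j\<in>{1..N}. 0 \<le> \<theta> l j \<omega> \<and> \<theta> l j \<omega> \<le> 1" if "l \<ge> 1" for l
    using that by (intro AE_finite_allI AE_uniform_unit_interval \<theta> unif) auto
  then have AE_\<theta>_nonneg: "AE \<omega> in P. \<forall>j\<in>{1..N}. 0 \<le> \<theta> l j \<omega>" if "l \<ge> 1" for l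
    using that by (force elim: eventually_mono)
  \<comment> \<open>Countably many null sets are merged into one that serves every
    subinterval.\<close>
  have AE_all_\<theta>: "AE \<omega> in P. \<forall>l\<ge>1. \<forall>j\<in>{1..N}. 0 \<le> \<theta> l j \<omega> \<and> \<theta> l j \<omega> \<le> 1"
    using AE_\<theta> by (simp add: AE_all_countable)
  define b where "b i = 1 - lam * h * (real (Suc i) / real M)" for i
  define L where "L = 1 + lam * h * (real N * ((\<Sum>i<M. b i) / (real N * (\<Sum>i<M. (b i)\<^sup>2) + \<delta>)))"
  have S_lim: "((\<lambda>(\<epsilon>, s, \<theta>). stability_index lam h \<delta> M N (\<epsilon> / h\<^sup>2) s \<theta>) \<longlongrightarrow> L) (shape_filter N)"
    unfolding L_def b_def using \<open>h > 0\<close> \<open>\<delta> > 0\<close> by (rule stability_index_tendsto)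
  have "\<bar>L\<bar> < 1"
    using limit_index_bound[of "- (lam * h)" \<delta> M N] assms by (simp add: L_def b_def)

  show "AE \<omega> in P. u l \<omega> =
      stability_index lam h \<delta> M N a (grid t0 h (l - 1)) (\<lambda>j. \<theta> l j \<omega>) * u (l - 1) \<omega>"
    if "a > 0" and scheme: "rpnn_scheme P lam h \<delta> M N a t0 u0 \<theta> w u" and "l \<ge> 1" for a w u l
  proof -
    let ?s = "grid t0 h (l - 1)"
    have u: "u (l - 1) \<in> borel_measurable P" "integrable P (\<lambda>\<omega>. (u (l - 1) \<omega>)\<^sup>2)"
      using rpnn_scheme_square_integrable[OF \<open>prob_space P\<close> \<open>\<delta> > 0\<close> \<open>a > 0\<close> \<theta> AE_\<theta>_nonneg scheme]
      by auto
    have w: "random_weights P N (w l)"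
      and min: "\<And>v. random_weights P N v \<Longrightarrow>
        expected_loss P lam h \<delta> M N a ?s (\<theta> l) (u (l - 1)) (w l)
        \<le> expected_loss P lam h \<delta> M N a ?s (\<theta> l) (u (l - 1)) v"
      and upd: "\<And>\<omega>. \<omega> \<in> space P \<Longrightarrow> u l \<omega> = ansatz h N a ?s (\<lambda>j. \<theta> l j \<omega>) (u (l - 1) \<omega>)
        (\<lambda>j. w l j \<omega>) (grid t0 h l)"
      using scheme \<open>l \<ge> 1\<close> by (auto simp: rpnn_scheme_def)
    \<comment> \<open>Uses \<open>l \<ge> 1\<close>, since \<open>l - 1\<close> is truncated
      subtraction.\<close>
    have "grid t0 h l = ?s + h"
      using \<open>l \<ge> 1\<close> by (simp add: grid_def of_nat_diff algebra_simps)
    have "expected_loss P lam h \<delta> M N a ?s (\<theta> l) (u (l - 1)) (w l) < \<infinity>"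
      using min[of "\<lambda>_ _. 0"] expected_loss_zero_weights_finite[OF _ u(2)] \<open>\<delta> > 0\<close>
      by (auto simp: random_weights_def intro: le_less_trans)
    then have "AE \<omega> in P. \<forall>j<N. ridge_grad M N \<delta> (lam * u (l - 1) \<omega>)
        (\<lambda>j i. colloc_mat lam h M N a ?s (\<lambda>j. \<theta> l j \<omega>) $$ (j, i)) (\<lambda>j. w l (Suc j) \<omega>) j = 0"
      by (intro expected_loss_minimizer_grad \<open>\<delta> > 0\<close> \<theta> \<open>l \<ge> 1\<close> u(1) w min)
    then show ?thesis
    proof (rule AE_mp, intro AE_I2 impI)
      fix \<omega> assume "\<omega> \<in> space P" and grad: "\<forall>j<N. ridge_grad M N \<delta> (lam * u (l - 1) \<omega>)
        (\<lambda>j i. colloc_mat lam h M N a ?s (\<lambda>j. \<theta> l j \<omega>) $$ (j, i)) (\<lambda>j. w l (Suc j) \<omega>) j = 0"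
      show "u l \<omega> = stability_index lam h \<delta> M N a ?s (\<lambda>j. \<theta> l j \<omega>) * u (l - 1) \<omega>"
        unfolding upd[OF \<open>\<omega> \<in> space P\<close>] \<open>grid t0 h l = ?s + h\<close>
        by (rule stability_index_step[OF \<open>\<delta> > 0\<close>]) (use grad in simp)
    qed
  qed

  show "AE \<omega> in P. \<forall>l\<ge>1. \<exists>L.
        ((\<lambda>\<epsilon>. stability_index lam h \<delta> M N (\<epsilon> / h\<^sup>2) (grid t0 h (l - 1)) (\<lambda>j. \<theta> l j \<omega>)) \<longlongrightarrow> L)
          (at_right 0) \<and> \<bar>L\<bar> < 1"
    using AE_all_\<theta>
  proof (rule AE_mp, intro AE_I2 impI allI)
    fix \<omega> and l :: nat
    assume "\<forall>l\<ge>1. \<forall>j\<in>{1..N}. 0 \<le> \<theta> l j \<omega> \<and> \<theta> l j \<omega> \<le> 1" and "l \<ge> 1"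
    \<comment> \<open>Outside the null set, fixing the endpoint and the parameters gives a path into
      \<open>shape_filter N\<close>, along which the uniform limit specializes.\<close>
    then have "filterlim (\<lambda>\<epsilon>. (\<epsilon>, grid t0 h (l - 1), \<lambda>j. \<theta> l j \<omega>)) (shape_filter N) (at_right 0)"
      unfolding shape_filter_def
      by (intro filterlim_Pair filterlim_ident) (auto simp: filterlim_principal)
    from filterlim_compose[OF S_lim this]
    show "\<exists>L. ((\<lambda>\<epsilon>. stability_index lam h \<delta> M N (\<epsilon> / h\<^sup>2) (grid t0 h (l - 1)) (\<lambda>j. \<theta> l j \<omega>)) \<longlongrightarrow> L)
          (at_right 0) \<and> \<bar>L\<bar> < 1"
      using \<open>\<bar>L\<bar> < 1\<close> by auto
  qed

  have "eventually (\<lambda>p. \<bar>case p of (\<epsilon>, s, \<theta>) \<Rightarrow> stability_index lam h \<delta> M N (\<epsilon> / h\<^sup>2) s \<theta>\<bar> < 1)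
      (shape_filter N)"
    by (rule order_tendstoD(2)[OF tendsto_rabs[OF S_lim] \<open>\<bar>L\<bar> < 1\<close>])
  then obtain \<epsilon>0 where "\<epsilon>0 > 0" and all: "\<forall>\<epsilon> s \<theta>. 0 < \<epsilon> \<longrightarrow> \<epsilon> < \<epsilon>0 \<longrightarrow>
      (\<forall>j\<in>{1..N}. 0 \<le> \<theta> j \<and> \<theta> j \<le> 1) \<longrightarrow> \<bar>stability_index lam h \<delta> M N (\<epsilon> / h\<^sup>2) s \<theta>\<bar> < 1"
    unfolding eventually_shape_filter prod.case by (elim exE conjE)
  have \<epsilon>0: "\<bar>stability_index lam h \<delta> M N (\<epsilon> / h\<^sup>2) s \<theta>\<bar> < 1"
    if "0 < \<epsilon>" "\<epsilon> < \<epsilon>0" "\<forall>j\<in>{1..N}. 0 \<le> \<theta> j \<and> \<theta> j \<le> 1" for \<epsilon> s \<theta>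
    using all that by blast
  show "\<exists>\<epsilon>0>0. AE \<omega> in P. \<forall>a>0. a * h\<^sup>2 < \<epsilon>0 \<longrightarrow>
        (\<forall>l\<ge>1. asymptotically_stable
           (stability_index lam h \<delta> M N a (grid t0 h (l - 1)) (\<lambda>j. \<theta> l j \<omega>)))"
  proof (intro exI[of _ \<epsilon>0] conjI \<open>\<epsilon>0 > 0\<close>)
    show "AE \<omega> in P. \<forall>a>0. a * h\<^sup>2 < \<epsilon>0 \<longrightarrow>
        (\<forall>l\<ge>1. asymptotically_stable
           (stability_index lam h \<delta> M N a (grid t0 h (l - 1)) (\<lambda>j. \<theta> l j \<omega>)))"
      using AE_all_\<theta>
    proof (rule AE_mp, intro AE_I2 impI allI)
      fix \<omega> a and l :: nat
      assume \<omega>: "\<forall>l\<ge>1. \<forall>j\<in>{1..N}. 0 \<le> \<theta> l j \<omega> \<and> \<theta> l j \<omega> \<le> 1" "l \<ge> 1"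
        and a: "a > 0" "a * h\<^sup>2 < \<epsilon>0"
      have "0 < a * h\<^sup>2"
        using a(1) \<open>h > 0\<close> by simp
      \<comment> \<open>The uniform threshold is applied with \<open>\<epsilon>\<close> equal to
        \<open>a * h\<^sup>2\<close>; dividing by \<open>h\<^sup>2\<close> recovers
        \<open>a\<close>.\<close>
      from \<epsilon>0[OF this a(2), of "\<lambda>j. \<theta> l j \<omega>"] \<omega>
      have "\<bar>stability_index lam h \<delta> M N (a * h\<^sup>2 / h\<^sup>2) (grid t0 h (l - 1)) (\<lambda>j. \<theta> l j \<omega>)\<bar> < 1"
        by blast
      then show "asymptotically_stable
          (stability_index lam h \<delta> M N a (grid t0 h (l - 1)) (\<lambda>j. \<theta> l j \<omega>))"
        using \<open>h > 0\<close> by (simp add: asymptotically_stable_def)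
    qed
  qed
qed

end
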